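(* Let $(\sigma,\mathbf{i})$ be an $e$-admissible pair of $\mathbb{M}\mathbb{C}(n)$, let $U\subseteq\mathbb{M}\mathbb{C}(n)$ be open, and let $F:U\to\mathbb{M}\mathbb{C}(n)$ be of class $C^1$. The following statements are equivalent. (i) $F$ satisfies the $(\sigma,\mathbf{i})$-anti-Cauchy--Riemann equations on $U$. (ii) $DF(\eta)\circ\mathcal{L}_{\mathbf{i}}=-\mathcal{L}_{\mathbf{i}}\circ DF(\eta)$ for every $\eta\in U$. (iii) $\sigma\circ F$ satisfies the $(\sigma,\mathbf{i})$-Cauchy--Riemann equations on $U$. (iv) $F\circ\sigma$ satisfies the $(\sigma,\mathbf{i})$-Cauchy--Riemann equations on $\sigma(U)$. In particular, the class of solutions of the $(\sigma,\mathbf{i})$-anti-Cauchy--Riemann equations on $U$, denoted by $\overline{\mathrm{Hol}}_{\mathbf{i}}(U)$, depends only on the unit $\mathbf{i}$, and $$\overline{\mathrm{Hol}}_{\mathbf{i}}(U)=\{\sigma\circ G: G\in\mathrm{Hol}_{\mathbf{i}}(U)\}=\{G\circ\sigma: G\in\mathrm{Hol}_{\mathbf{i}}(\sigma(U))\}$$ for every involution $\sigma$ such that $(\sigma,\mathbf{i})$ is an $e$-admissible pair.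
   Context: Let $n\ge1$. The multicomplex numbers are defined recursively by $\mathbb{M}\mathbb{C}(0)=\mathbb{R}$ and $\mathbb{M}\mathbb{C}(n)=\{\eta_1+\eta_2\mathbf{i}_n:\eta_1,\eta_2\in\mathbb{M}\mathbb{C}(n-1)\}$ with $\mathbf{i}_n^2=-1$, where $\mathbf{i}_n$ is a new formal square root of $-1$ commuting with everything. Thus $\mathbb{M}\mathbb{C}(n)$ is a commutative unital real algebra of dimension $2^n$ generated by commuting units $\mathbf{i}_1,\dots,\mathbf{i}_n$ with $\mathbf{i}_k^2=-1$, with real basis $\mathbb{I}(n):=\{\mathbf{i}_1^{a_1}\cdots\mathbf{i}_n^{a_n}: a_k\in\{0,1\}\}$. Put $\pm\mathbb{I}(n):=\{\pm\mathbf{j}:\mathbf{j}\in\mathbb{I}(n)\}$. An involution of $\mathbb{M}\mathbb{C}(n)$ is a real-linear multiplicative map $\sigma$ with $\sigma\circ\sigma=\mathrm{Id}$; it is $\mathbb{I}(n)$-preserving if it maps $\mathbb{I}(n)$ into $\pm\mathbb{I}(n)$. An $e$-admissible pair $(\sigma,\mathbf{i})$ consists of an $\mathbb{I}(n)$-preserving involution $\sigma$ and an element $\mathbf{i}\in\mathbb{I}(n)$ with $\mathbf{i}^2=-1$ and $\sigma(\mathbf{i})=-\mathbf{i}$. Write $\mathcal{L}_{\mathbf{i}}(\eta)=\mathbf{i}\eta$ and $\mathcal{B}_\sigma:=\{\eta\in\mathbb{M}\mathbb{C}(n):\sigma(\eta)=\eta\}$. "Class $C^1$" means continuously differentiable as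 a map between real vector spaces, and $DF(\eta)$ is the real differential. A $C^1$ function $F$ on an open set $V$ satisfies the $(\sigma,\mathbf{i})$-Cauchy--Riemann equations on $V$ if $DF(\eta)[\mathbf{i}\beta]=\mathbf{i}\,DF(\eta)[\beta]$ for all $\eta\in V$, $\beta\in\mathcal{B}_\sigma$, and the $(\sigma,\mathbf{i})$-anti-Cauchy--Riemann equations on $V$ if $DF(\eta)[\mathbf{i}\beta]=-\mathbf{i}\,DF(\eta)[\beta]$ for all $\eta\in V$, $\beta\in\mathcal{B}_\sigma$. $\mathrm{Hol}_{\mathbf{i}}(V)$ is the set of $C^1$ functions $G:V\to\mathbb{M}\mathbb{C}(n)$ with $DG(\eta)\circ\mathcal{L}_{\mathbf{i}}=\mathcal{L}_{\mathbf{i}}\circ DG(\eta)$ for every $\eta\in V$. *)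

theory Defs
  imports "HOL-Analysis.Analysis"
begin

text \<open>
  The multicomplex numbers are built by the recursion
  \<open>MC(0) = \<real>\<close>, \<open>MC(n) = {a + b \<i>\<^sub>n | a b \<in> MC(n-1)}\<close>.
  The element \<open>a + b \<i>\<^sub>n\<close> is the tree \<open>Node a b\<close>, so the carrier \<open>MC n\<close> consists
  of the perfect binary trees of height \<open>n\<close> with real leaves; \<open>MC(n-1)\<close> sits
  inside \<open>MC(n)\<close> via \<open>a \<mapsto> Node a 0\<close>.  The tree operations below are only meaningful on two trees of
  the same height.
\<close>

datatype mctree = Leaf real | Node mctree mctree

primrec MC :: "nat \<Rightarrow> mctree set" where
  "MC 0 = range Leaf"
| "MC (Suc n) = {Node a b | a b. a \<in> MC n \<and> b \<in> MC n}"

fun tadd :: "mctree \<Rightarrow> mctree \<Rightarrow> mctree" where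
  "tadd (Leaf x) (Leaf y) = Leaf (x + y)"
| "tadd (Node a b) (Node c d) = Node (tadd a c) (tadd b d)"

primrec tscale :: "real \<Rightarrow> mctree \<Rightarrow> mctree" where
  "tscale r (Leaf x) = Leaf (r * x)"
| "tscale r (Node a b) = Node (tscale r a) (tscale r b)"

text \<open>\<open>(a + b \<i>\<^sub>n) (c + d \<i>\<^sub>n) = (a c - b d) + (a d + b c) \<i>\<^sub>n\<close>\<close>

fun tmul :: "mctree \<Rightarrow> mctree \<Rightarrow> mctree" where
  "tmul (Leaf x) (Leaf y) = Leaf (x * y)"
| "tmul (Node a b) (Node c d) =
     Node (tadd (tmul a c) (tscale (-1) (tmul b d))) (tadd (tmul a d) (tmul b c))"

fun tinner :: "mctree \<Rightarrow> mctree \<Rightarrow> real" where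
  "tinner (Leaf x) (Leaf y) = x * y"
| "tinner (Node a b) (Node c d) = tinner a c + tinner b d"

primrec tzero :: "nat \<Rightarrow> mctree" where
  "tzero 0 = Leaf 0"
| "tzero (Suc n) = Node (tzero n) (tzero n)"

primrec tone :: "nat \<Rightarrow> mctree" where
  "tone 0 = Leaf 1"
| "tone (Suc n) = Node (tone n) (tzero n)"

text \<open>\<open>tunit n k\<close> is the unit \<open>\<i>\<^sub>k\<close> of \<open>MC(n)\<close>, for \<open>1 \<le> k \<le> n\<close>.\<close>

primrec tunit :: "nat \<Rightarrow> nat \<Rightarrow> mctree" where
  "tunit 0 k = tzero 0"
| "tunit (Suc n) k = (if k = Suc n then Node (tzero n) (tone n) else Node (tunit n k) (tzero n))"

primrec tbasis :: "nat \<Rightarrow> mctree set" where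
  "tbasis 0 = {Leaf 1}"
| "tbasis (Suc n) = (\<lambda>b. Node b (tzero n)) ` tbasis n \<union> Node (tzero n) ` tbasis n"

lemma MC_SucE:
  assumes "x \<in> MC (Suc n)"
  obtains a b where "x = Node a b" "a \<in> MC n" "b \<in> MC n"
  using assms by auto

lemma MC_closed [simp]:
  "tzero n \<in> MC n" "tone n \<in> MC n" "tunit n k \<in> MC n"
  "x \<in> MC n \<Longrightarrow> tscale r x \<in> MC n"
  "x \<in> MC n \<Longrightarrow> y \<in> MC n \<Longrightarrow> tadd x y \<in> MC n"
proof -
  show a: "tzero n \<in> MC n" for n by (induction n) auto
  show b: "tone n \<in> MC n" for n by (induction n) (auto simp: a)
  show "tunit n k \<in> MC n" by (induction n) (auto simp: a b)
  show "x \<in> MC n \<Longrightarrow> tscale r x \<in> MC n" by (induction n arbitrary: x) auto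
  show "x \<in> MC n \<Longrightarrow> y \<in> MC n \<Longrightarrow> tadd x y \<in> MC n"
    by (induction n arbitrary: x y) auto
qed

lemma tmul_closed [simp]: "x \<in> MC n \<Longrightarrow> y \<in> MC n \<Longrightarrow> tmul x y \<in> MC n"
  by (induction n arbitrary: x y) auto

lemma tbasis_closed: "tbasis n \<subseteq> MC n"
  by (induction n) auto

lemma tadd_assoc:
  "x \<in> MC n \<Longrightarrow> y \<in> MC n \<Longrightarrow> z \<in> MC n \<Longrightarrow> tadd (tadd x y) z = tadd x (tadd y z)"
  by (induction n arbitrary: x y z) (auto elim!: MC_SucE)

lemma tadd_comm: "x \<in> MC n \<Longrightarrow> y \<in> MC n \<Longrightarrow> tadd x y = tadd y x"
  by (induction n arbitrary: x y) (auto elim!: MC_SucE)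

lemma tadd_left_comm:
  "x \<in> MC n \<Longrightarrow> y \<in> MC n \<Longrightarrow> z \<in> MC n \<Longrightarrow> tadd x (tadd y z) = tadd y (tadd x z)"
  by (metis tadd_assoc tadd_comm)

lemma tadd_swap:
  assumes "x \<in> MC n" "y \<in> MC n" "z \<in> MC n" "w \<in> MC n"
  shows "tadd (tadd x y) (tadd z w) = tadd (tadd x z) (tadd y w)"
proof -
  have "tadd (tadd x y) (tadd z w) = tadd x (tadd y (tadd z w))"
    using assms by (intro tadd_assoc[of _ n]) simp_all
  also have "tadd y (tadd z w) = tadd z (tadd y w)"
    using assms by (intro tadd_left_comm[of _ n]) simp_all
  also have "tadd x (tadd z (tadd y w)) = tadd (tadd x z) (tadd y w)"
    using assms by (intro tadd_assoc[of _ n, symmetric]) simp_all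
  finally show ?thesis .
qed

lemma tadd_swap2:
  assumes "x \<in> MC n" "y \<in> MC n" "z \<in> MC n" "w \<in> MC n"
  shows "tadd (tadd x y) (tadd z w) = tadd (tadd x z) (tadd w y)"
  using tadd_swap[OF assms] tadd_comm[OF assms(2,4)] by simp

lemma tadd_zero: "x \<in> MC n \<Longrightarrow> tadd (tzero n) x = x"
  by (induction n arbitrary: x) auto

lemma tadd_zero_right: "x \<in> MC n \<Longrightarrow> tadd x (tzero n) = x"
  by (induction n arbitrary: x) auto

lemma tadd_neg: "x \<in> MC n \<Longrightarrow> tadd (tscale (-1) x) x = tzero n"
  by (induction n arbitrary: x) auto

lemma tscale_add: "x \<in> MC n \<Longrightarrow> y \<in> MC n \<Longrightarrow> tscale r (tadd x y) = tadd (tscale r x) (tscale r y)"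
  by (induction n arbitrary: x y) (auto elim!: MC_SucE simp: algebra_simps)

lemma tscale_add_left: "x \<in> MC n \<Longrightarrow> tscale (r + s) x = tadd (tscale r x) (tscale s x)"
  by (induction n arbitrary: x) (auto simp: algebra_simps)

lemma tscale_scale: "tscale r (tscale s x) = tscale (r * s) x"
  by (induction x) auto

lemma tscale_one: "tscale 1 x = x"
  by (induction x) auto

lemma tmul_scale_left: "x \<in> MC n \<Longrightarrow> y \<in> MC n \<Longrightarrow> tmul (tscale r x) y = tscale r (tmul x y)"
proof (induction n arbitrary: x y)
  case (Suc n)
  then show ?case
    by (auto simp: tscale_add[of _ n] tscale_scale algebra_simps)
qed auto

lemma tmul_comm: "x \<in> MC n \<Longrightarrow> y \<in> MC n \<Longrightarrow> tmul x y = tmul y x"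
proof (induction n arbitrary: x y)
  case (Suc n)
  then obtain a b c d where "x = Node a b" "y = Node c d"
    "a \<in> MC n" "b \<in> MC n" "c \<in> MC n" "d \<in> MC n" by (auto elim!: MC_SucE)
  then show ?case
    by (simp add: Suc.IH[of a c] Suc.IH[of b d] Suc.IH[of a d] Suc.IH[of b c]) (rule tadd_comm[of _ n]; simp)
qed auto

lemma tmul_scale_right: "x \<in> MC n \<Longrightarrow> y \<in> MC n \<Longrightarrow> tmul x (tscale r y) = tscale r (tmul x y)"
  by (metis tmul_comm tmul_scale_left MC_closed(4))

lemma tmul_distrib_right:
  "x \<in> MC n \<Longrightarrow> y \<in> MC n \<Longrightarrow> z \<in> MC n \<Longrightarrow> tmul (tadd x y) z = tadd (tmul x z) (tmul y z)"
proof (induction n arbitrary: x y z)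
  case (Suc n)
  then obtain a b c d e f where "x = Node a b" "y = Node c d" "z = Node e f"
    "a \<in> MC n" "b \<in> MC n" "c \<in> MC n" "d \<in> MC n" "e \<in> MC n" "f \<in> MC n" by (auto elim!: MC_SucE)
  then show ?case
    by (simp add: Suc.IH tscale_add[of _ n]) (intro conjI tadd_swap[of _ n]; simp)
qed (auto simp: algebra_simps)

lemma tmul_distrib_left:
  "x \<in> MC n \<Longrightarrow> y \<in> MC n \<Longrightarrow> z \<in> MC n \<Longrightarrow> tmul x (tadd y z) = tadd (tmul x y) (tmul x z)"
  using tmul_comm[of x n "tadd y z"] tmul_comm[of x n y] tmul_comm[of x n z]
  by (simp add: tmul_distrib_right)

lemma tmul_assoc:
  "x \<in> MC n \<Longrightarrow> y \<in> MC n \<Longrightarrow> z \<in> MC n \<Longrightarrow> tmul (tmul x y) z = tmul x (tmul y z)"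
proof (induction n arbitrary: x y z)
  case (Suc n)
  then obtain a b c d e f where "x = Node a b" "y = Node c d" "z = Node e f"
    "a \<in> MC n" "b \<in> MC n" "c \<in> MC n" "d \<in> MC n" "e \<in> MC n" "f \<in> MC n" by (auto elim!: MC_SucE)
  then show ?case
    by (simp add: Suc.IH tscale_add[of _ n] tmul_distrib_left[of _ n] tmul_distrib_right[of _ n]
        tmul_scale_left[of _ n] tmul_scale_right[of _ n])
      (intro conjI tadd_swap2[of _ n]; simp)
qed auto

lemma tscale_zero [simp]: "tscale r (tzero n) = tzero n"
  by (induction n) auto

lemma tmul_zero [simp]: "x \<in> MC n \<Longrightarrow> tmul (tzero n) x = tzero n"
  by (induction n arbitrary: x) (auto simp: tadd_zero)

lemma tmul_zero_right [simp]: "x \<in> MC n \<Longrightarrow> tmul x (tzero n) = tzero n"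
  using tmul_comm[of x n "tzero n"] by simp

lemma tmul_one: "x \<in> MC n \<Longrightarrow> tmul (tone n) x = x"
proof (induction n arbitrary: x)
  case (Suc n)
  then show ?case using tadd_comm[of _ n "tzero n"] by (auto simp: tadd_zero)
qed auto

lemma tzero_neq_tone: "tzero n \<noteq> tone n"
  by (induction n) auto

lemma tinner_comm: "x \<in> MC n \<Longrightarrow> y \<in> MC n \<Longrightarrow> tinner x y = tinner y x"
  by (induction n arbitrary: x y) (auto elim!: MC_SucE)

lemma tinner_add:
  "x \<in> MC n \<Longrightarrow> y \<in> MC n \<Longrightarrow> z \<in> MC n \<Longrightarrow> tinner (tadd x y) z = tinner x z + tinner y z"
  by (induction n arbitrary: x y z) (auto elim!: MC_SucE simp: algebra_simps)

lemma tinner_scale: "x \<in> MC n \<Longrightarrow> y \<in> MC n \<Longrightarrow> tinner (tscale r x) y = r * tinner x y"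
  by (induction n arbitrary: x y) (auto elim!: MC_SucE simp: algebra_simps)

lemma tinner_nonneg: "x \<in> MC n \<Longrightarrow> 0 \<le> tinner x x"
  by (induction n arbitrary: x) auto

lemma tinner_eq_0: "x \<in> MC n \<Longrightarrow> tinner x x = 0 \<longleftrightarrow> x = tzero n"
proof (induction n arbitrary: x)
  case (Suc n)
  then show ?case by (auto simp: add_nonneg_eq_0_iff tinner_nonneg)
qed auto

lemma tinner_zero [simp]:
  "x \<in> MC n \<Longrightarrow> tinner (tzero n) x = 0" "x \<in> MC n \<Longrightarrow> tinner x (tzero n) = 0"
  by (induction n arbitrary: x) auto

lemma tbasis_finite: "finite (tbasis n)"
  by (induction n) auto

lemma tbasis_nonempty: "tbasis n \<noteq> {}"
  by (induction n) auto

lemma tzero_notin_tbasis: "tzero n \<notin> tbasis n"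
  by (induction n) auto

lemma card_tbasis: "card (tbasis n) = 2 ^ n"
proof (induction n)
  case (Suc n)
  have "(\<lambda>b. Node b (tzero n)) ` tbasis n \<inter> Node (tzero n) ` tbasis n = {}"
    using tzero_notin_tbasis[of n] by auto
  then show ?case
    by (simp add: card_Un_disjoint tbasis_finite card_image inj_on_def Suc)
qed auto

lemma tbasis_inner:
  "u \<in> tbasis n \<Longrightarrow> v \<in> tbasis n \<Longrightarrow> tinner u v = (if u = v then 1 else 0)"
proof (induction n arbitrary: u v)
  case (Suc n)
  then show ?case using tbasis_closed[of n] tzero_notin_tbasis[of n] by (auto simp: subset_eq split: if_splits)
qed auto

lemma tbasis_all_zero: "x \<in> MC n \<Longrightarrow> (\<forall>u\<in>tbasis n. tinner x u = 0) \<longleftrightarrow> x = tzero n"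
proof (induction n arbitrary: x)
  case (Suc n)
  then show ?case using tbasis_closed[of n] by (auto simp: ball_Un subset_eq)
qed auto

text \<open>
  The type \<open>'n mc\<close> is \<open>MC(n)\<close> with \<open>n = CARD('n)\<close>; every \<open>n \<ge> 1\<close> arises for some
  \<open>'n\<close> of class \<open>finite\<close>.
\<close>

typedef 'n mc = "MC CARD('n)"
  using MC_closed(1) by blast

setup_lifting type_definition_mc

instantiation mc :: (type) "{comm_ring_1, real_algebra_1}"
begin

lift_definition zero_mc :: "'a mc" is "tzero CARD('a)" by simp
lift_definition one_mc :: "'a mc" is "tone CARD('a)" by simp
lift_definition plus_mc :: "'a mc \<Rightarrow> 'a mc \<Rightarrow> 'a mc" is tadd by simp
lift_definition times_mc :: "'a mc \<Rightarrow> 'a mc \<Rightarrow> 'a mc" is tmul by simp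
lift_definition scaleR_mc :: "real \<Rightarrow> 'a mc \<Rightarrow> 'a mc" is tscale by simp
lift_definition uminus_mc :: "'a mc \<Rightarrow> 'a mc" is "tscale (-1)" by simp
lift_definition minus_mc :: "'a mc \<Rightarrow> 'a mc \<Rightarrow> 'a mc" is "\<lambda>x y. tadd x (tscale (-1) y)" by simp

instance
proof
  fix a b c :: "'a mc" and r s :: real
  show "a + b + c = a + (b + c)" by transfer (rule tadd_assoc)
  show "a + b = b + a" by transfer (rule tadd_comm)
  show "0 + a = a" by transfer (rule tadd_zero)
  show "- a + a = 0" by transfer (rule tadd_neg)
  show "a - b = a + - b" by transfer simp
  show "a * b * c = a * (b * c)" by transfer (rule tmul_assoc)
  show "a * b = b * a" by transfer (rule tmul_comm)
  show "1 * a = a" by transfer (rule tmul_one)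
  show "(a + b) * c = a * c + b * c" by transfer (rule tmul_distrib_right)
  show "a * (b + c) = a * b + a * c" by transfer (rule tmul_distrib_left)
  show "a * 1 = a" by transfer (metis tmul_comm tmul_one MC_closed(2))
  show "(0 :: 'a mc) \<noteq> 1" by transfer (rule tzero_neq_tone)
  show "r *\<^sub>R (a + b) = r *\<^sub>R a + r *\<^sub>R b" by transfer (rule tscale_add)
  show "(r + s) *\<^sub>R a = r *\<^sub>R a + s *\<^sub>R a" by transfer (rule tscale_add_left)
  show "r *\<^sub>R s *\<^sub>R a = (r * s) *\<^sub>R a" by transfer (rule tscale_scale)
  show "1 *\<^sub>R a = a" by transfer (rule tscale_one)
  show "r *\<^sub>R a * b = r *\<^sub>R (a * b)" by transfer (rule tmul_scale_left)
  show "a * r *\<^sub>R b = r *\<^sub>R (a * b)" by transfer (rule tmul_scale_right)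
qed

end

text \<open>
  The Euclidean structure of the \<open>2^n\<close> leaf coordinates only serves to provide the (unique)
  Hausdorff vector space topology.
\<close>

instantiation mc :: (type) euclidean_space
begin

lift_definition inner_mc :: "'a mc \<Rightarrow> 'a mc \<Rightarrow> real" is tinner .
lift_definition Basis_mc :: "'a mc set" is "tbasis CARD('a)"
  using tbasis_closed by (auto simp: subset_eq)

definition norm_mc :: "'a mc \<Rightarrow> real" where "norm_mc x = sqrt (inner x x)"
definition dist_mc :: "'a mc \<Rightarrow> 'a mc \<Rightarrow> real" where "dist_mc x y = norm (x - y)"
definition sgn_mc :: "'a mc \<Rightarrow> 'a mc" where "sgn_mc x = x /\<^sub>R norm x"
definition uniformity_mc :: "('a mc \<times> 'a mc) filter"
  where "uniformity_mc = (INF e\<in>{0<..}. principal {(x, y). dist x y < e})"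
definition open_mc :: "'a mc set \<Rightarrow> bool"
  where "open_mc U = (\<forall>x\<in>U. \<forall>\<^sub>F (x', y) in uniformity. x' = x \<longrightarrow> y \<in> U)"

instance
proof
  fix x y z :: "'a mc" and r :: real and U :: "'a mc set" and u v :: "'a mc"
  show "dist x y = norm (x - y)" by (rule dist_mc_def)
  show "sgn x = x /\<^sub>R norm x" by (rule sgn_mc_def)
  show "uniformity = (INF e\<in>{0<..}. principal {(x, y::'a mc). dist x y < e})"
    by (rule uniformity_mc_def)
  show "open U = (\<forall>x\<in>U. \<forall>\<^sub>F (x', y) in uniformity. x' = x \<longrightarrow> y \<in> U)" by (rule open_mc_def)
  show "inner x y = inner y x" by transfer (rule tinner_comm)
  show "inner (x + y) z = inner x z + inner y z" by transfer (rule tinner_add)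
  show "inner (r *\<^sub>R x) y = r * inner x y" by transfer (rule tinner_scale)
  show "0 \<le> inner x x" by transfer (rule tinner_nonneg)
  show "inner x x = 0 \<longleftrightarrow> x = 0" by transfer (rule tinner_eq_0)
  show "norm x = sqrt (inner x x)" by (rule norm_mc_def)
  show "finite (Basis :: 'a mc set)" by transfer (rule tbasis_finite)
  show "(Basis :: 'a mc set) \<noteq> {}" by transfer (rule tbasis_nonempty)
  show "u \<in> Basis \<Longrightarrow> v \<in> Basis \<Longrightarrow> inner u v = (if u = v then 1 else 0)"
    by transfer (rule tbasis_inner)
  show "(\<forall>u\<in>Basis. inner x u = 0) \<longleftrightarrow> x = 0" by transfer (rule tbasis_all_zero)
qed

end

lemma DIM_mc: "DIM('n mc) = 2 ^ CARD('n)"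
  by transfer (rule card_tbasis)

lift_definition mc_unit :: "nat \<Rightarrow> 'n mc" is "tunit CARD('n)" by simp

definition mc_basis :: "'n mc set" where
  "mc_basis = {\<Prod>k = 1..CARD('n). mc_unit k ^ a k | a. \<forall>k. a k \<in> {0, 1 :: nat}}"

definition mc_signed_basis :: "'n mc set" where
  "mc_signed_basis = mc_basis \<union> uminus ` mc_basis"

lemma tunit_square:
  "1 \<le> k \<Longrightarrow> k \<le> n \<Longrightarrow> tmul (tunit n k) (tunit n k) = tscale (-1) (tone n)"
  by (induction n) (auto simp: tmul_one tadd_zero tadd_zero_right le_Suc_eq)

lemma mc_unit_square:
  "1 \<le> k \<Longrightarrow> k \<le> CARD('n) \<Longrightarrow> (mc_unit k :: 'n mc) * mc_unit k = - 1"
  by transfer (rule tunit_square)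

text \<open>The basis \<open>\<I>(n)\<close> of products of units is the coordinate basis of the type.\<close>

primrec tprod :: "nat \<Rightarrow> (nat \<Rightarrow> nat) \<Rightarrow> mctree" where
  "tprod 0 a = Leaf 1"
| "tprod (Suc n) a =
     (if a (Suc n) = 0 then Node (tprod n a) (tzero n) else Node (tzero n) (tprod n a))"

lemma tprod_closed [simp]: "tprod n a \<in> MC n"
  by (induction n) auto

lemma tprod_cong: "(\<And>k. 1 \<le> k \<Longrightarrow> k \<le> n \<Longrightarrow> a k = b k) \<Longrightarrow> tprod n a = tprod n b"
  by (induction n) auto

lemma tprod_none: "(\<And>k. a k = 0) \<Longrightarrow> tprod n a = tone n"
  by (induction n) auto

lemma tprod_unit:
  "1 \<le> k \<Longrightarrow> k \<le> n \<Longrightarrow> a k = 0 \<Longrightarrow> tmul (tprod n a) (tunit n k) = tprod n (a(k := 1))"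
proof (induction n)
  case (Suc n)
  have o: "tmul x (tone n) = x" if "x \<in> MC n" for x
    using that by (simp add: tmul_comm[of x n "tone n"] tmul_one)
  show ?case
  proof (cases "k = Suc n")
    case True
    have "tprod n (a(k := 1)) = tprod n a" using True by (intro tprod_cong) auto
    with True Suc.prems show ?thesis
      by (simp add: o tadd_zero tadd_zero_right del: fun_upd_apply) simp
  next
    case False
    with Suc show ?thesis by (auto simp: o tadd_zero tadd_zero_right)
  qed
qed auto

lemma Rep_mc_prod:
  assumes "\<forall>k. a k \<in> {0, 1}" "m \<le> CARD('n)"
  shows "Rep_mc (\<Prod>k = 1..m. (mc_unit k :: 'n mc) ^ a k) =
         tprod CARD('n) (\<lambda>k. if k \<le> m then a k else 0)"
  using assms(2)
proof (induction m)
  case 0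
  have "tprod CARD('n) (\<lambda>k. if k \<le> 0 then a k else 0) = tprod CARD('n) (\<lambda>k. 0)"
    by (rule tprod_cong) auto
  then show ?case by (simp add: one_mc.rep_eq tprod_none)
next
  case (Suc m)
  let ?b = "\<lambda>m k. if k \<le> m then a k else 0"
  show ?case
  proof (cases "a (Suc m) = 0")
    case True
    then have "?b (Suc m) = ?b m" by (auto simp: fun_eq_iff le_Suc_eq)
    with Suc True show ?thesis by simp
  next
    case False
    then have 1: "a (Suc m) = 1" using assms(1)[rule_format, of "Suc m"] by simp
    then have "?b (Suc m) = (?b m)(Suc m := 1)" by (auto simp: fun_eq_iff le_Suc_eq)
    with Suc 1 show ?thesis
      by (simp add: times_mc.rep_eq mc_unit.rep_eq tprod_unit)
  qed
qed

lemma tbasis_tprod: "tbasis n = {tprod n a | a. \<forall>k. a k \<in> {0, 1}}"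
proof (induction n)
  case (Suc n)
  show ?case
  proof (intro equalityI subsetI)
    fix x assume "x \<in> tbasis (Suc n)"
    then obtain a where a: "\<forall>k. a k \<in> {0, 1}"
      "x = Node (tprod n a) (tzero n) \<or> x = Node (tzero n) (tprod n a)"
      using Suc by auto
    have "tprod n (a(Suc n := c)) = tprod n a" for c by (intro tprod_cong) auto
    then have "x = tprod (Suc n) (a(Suc n := 0)) \<or> x = tprod (Suc n) (a(Suc n := 1))"
      using a by auto
    moreover have "\<forall>k. (a(Suc n := c)) k \<in> {0, 1}" if "c \<in> {0, 1}" for c
      using a that by auto
    ultimately show "x \<in> {tprod (Suc n) a | a. \<forall>k. a k \<in> {0, 1}}" by blast
  next
    fix x assume "x \<in> {tprod (Suc n) a | a. \<forall>k. a k \<in> {0, 1}}"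
    then obtain a where a: "\<forall>k. a k \<in> {0, 1}" "x = tprod (Suc n) a" by blast
    then have "tprod n a \<in> tbasis n" using Suc by blast
    with a(2) show "x \<in> tbasis (Suc n)" by simp
  qed
qed auto

lemma mc_basis_eq_Basis: "(mc_basis :: 'n mc set) = Basis"
proof -
  let ?P = "\<lambda>a. \<Prod>k = 1..CARD('n). (mc_unit k :: 'n mc) ^ a k"
  let ?A = "{a :: nat \<Rightarrow> nat. \<forall>k. a k \<in> {0, 1}}"
  have P: "Rep_mc (?P a) = tprod CARD('n) a" if "a \<in> ?A" for a
  proof -
    have "Rep_mc (?P a) = tprod CARD('n) (\<lambda>k. if k \<le> CARD('n) then a k else 0)"
      using that by (intro Rep_mc_prod) auto
    also have "\<dots> = tprod CARD('n) a" by (rule tprod_cong) auto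
    finally show ?thesis .
  qed
  have "Rep_mc ` (mc_basis :: 'n mc set) = (\<lambda>a. Rep_mc (?P a)) ` ?A"
    unfolding mc_basis_def by blast
  also have "\<dots> = tprod CARD('n) ` ?A"
    using P by (rule image_cong[OF refl])
  also have "\<dots> = tbasis CARD('n)"
    unfolding tbasis_tprod by blast
  also have "\<dots> = Rep_mc ` (Basis :: 'n mc set)"
    by (simp add: Basis_mc.rep_eq)
  finally show ?thesis
    by (metis inj_image_eq_iff inj_def Rep_mc_inject)
qed

definition mc_involution :: "('n mc \<Rightarrow> 'n mc) \<Rightarrow> bool" where
  "mc_involution \<sigma> \<longleftrightarrow> linear \<sigma> \<and> (\<forall>x y. \<sigma> (x * y) = \<sigma> x * \<sigma> y) \<and> \<sigma> \<circ> \<sigma> = id"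

definition basis_preserving :: "('n mc \<Rightarrow> 'n mc) \<Rightarrow> bool" where
  "basis_preserving \<sigma> \<longleftrightarrow> \<sigma> ` mc_basis \<subseteq> mc_signed_basis"

definition e_admissible :: "('n mc \<Rightarrow> 'n mc) \<Rightarrow> 'n mc \<Rightarrow> bool" where
  "e_admissible \<sigma> i \<longleftrightarrow>
     mc_involution \<sigma> \<and> basis_preserving \<sigma> \<and> i \<in> mc_basis \<and> i\<^sup>2 = -1 \<and> \<sigma> i = - i"

definition mult_by :: "'n mc \<Rightarrow> 'n mc \<Rightarrow> 'n mc" where
  "mult_by i \<eta> = i * \<eta>"

definition fixed_space :: "('n mc \<Rightarrow> 'n mc) \<Rightarrow> 'n mc set" where
  "fixed_space \<sigma> = {\<eta>. \<sigma> \<eta> = \<eta>}"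

text \<open>
  A function on an open set \<open>V\<close> is represented by a total function whose values outside \<open>V\<close>
  are irrelevant: for open \<open>V\<close>, all notions below depend only on the restriction to \<open>V\<close>.
  The sets \<open>Hol\<close> and \<open>antiHol\<close> of total functions are therefore closed under changing
  values outside \<open>V\<close>.
\<close>

definition C1_on :: "'a::real_normed_vector set \<Rightarrow> ('a \<Rightarrow> 'b::real_normed_vector) \<Rightarrow> bool" where
  "C1_on V F \<longleftrightarrow> (\<exists>F' :: 'a \<Rightarrow> 'a \<Rightarrow>\<^sub>L 'b.
     (\<forall>x\<in>V. (F has_derivative blinfun_apply (F' x)) (at x)) \<and> continuous_on V F')"

abbreviation DF :: "('a::real_normed_vector \<Rightarrow> 'b::real_normed_vector) \<Rightarrow> 'a \<Rightarrow> 'a \<Rightarrow> 'b" where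
  "DF F \<eta> \<equiv> frechet_derivative F (at \<eta>)"

definition cauchy_riemann ::
  "('n mc \<Rightarrow> 'n mc) \<Rightarrow> 'n mc \<Rightarrow> 'n mc set \<Rightarrow> ('n mc \<Rightarrow> 'n mc) \<Rightarrow> bool" where
  "cauchy_riemann \<sigma> i V F \<longleftrightarrow> C1_on V F \<and>
     (\<forall>\<eta>\<in>V. \<forall>\<beta>\<in>fixed_space \<sigma>. DF F \<eta> (i * \<beta>) = i * DF F \<eta> \<beta>)"

definition anti_cauchy_riemann ::
  "('n mc \<Rightarrow> 'n mc) \<Rightarrow> 'n mc \<Rightarrow> 'n mc set \<Rightarrow> ('n mc \<Rightarrow> 'n mc) \<Rightarrow> bool" where
  "anti_cauchy_riemann \<sigma> i V F \<longleftrightarrow> C1_on V F \<and>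
     (\<forall>\<eta>\<in>V. \<forall>\<beta>\<in>fixed_space \<sigma>. DF F \<eta> (i * \<beta>) = - (i * DF F \<eta> \<beta>))"

definition Hol :: "'n mc \<Rightarrow> 'n mc set \<Rightarrow> ('n mc \<Rightarrow> 'n mc) set" where
  "Hol i V = {G. C1_on V G \<and> (\<forall>\<eta>\<in>V. DF G \<eta> \<circ> mult_by i = mult_by i \<circ> DF G \<eta>)}"

definition antiHol :: "('n mc \<Rightarrow> 'n mc) \<Rightarrow> 'n mc \<Rightarrow> 'n mc set \<Rightarrow> ('n mc \<Rightarrow> 'n mc) set" where
  "antiHol \<sigma> i V = {F. anti_cauchy_riemann \<sigma> i V F}"

end

theory Submission
  imports Defs
begin

text \<open>
  Everything happens pointwise, at the level of the real-linear map \<open>D = DF F \<eta>\<close>.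

  The fixed space \<open>B\<close> of \<open>\<sigma>\<close> is only half of the algebra, but since \<open>\<sigma> i = - i\<close> and
  \<open>i\<^sup>2 = - 1\<close>, the other eigenspace of \<open>\<sigma>\<close> is exactly \<open>i B\<close>; so every element is
  \<open>a + i b\<close> with \<open>a, b \<in> B\<close>.  A sign rule \<open>D (i \<beta>) = \<plusminus> i D \<beta>\<close> on \<open>B\<close> propagates to \<open>i B\<close>:
  \<open>\<plusminus> i D (i b) = \<plusminus> i (\<plusminus> i D b) = - D b = D (i (i b))\<close>, because the square of the sign is 1.
  Hence both kinds of Cauchy--Riemann equations are (anti)commutation of \<open>D\<close> with
  multiplication by \<open>i\<close> on the whole algebra, a condition in which \<open>\<sigma>\<close> no longer occurs
  (lemma \<open>commutation_from_fixed_space\<close>).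

  Multiplication by \<open>i\<close> anticommutes with \<open>\<sigma>\<close>.  By the chain rule, composing \<open>F\<close> with \<open>\<sigma>\<close> on
  either side replaces \<open>D\<close> by \<open>\<sigma> \<circ> D\<close> or \<open>D \<circ> \<sigma>\<close>, and thus flips the sign of the commutation
  rule (lemmas \<open>intertwines_left_comp\<close> and \<open>intertwines_right_comp\<close>).  As \<open>\<sigma>\<close> is its own
  inverse, each flip can be undone by the same operation; this gives the equivalences and the
  two descriptions of the antiholomorphic functions.
\<close>

text \<open>
  Keeping the sign as a real parameter \<open>c\<close> lets the holomorphic (\<open>c = 1\<close>) and the
  antiholomorphic (\<open>c = -1\<close>) case be treated at once.
\<close>

definition intertwines :: "real \<Rightarrow> 'n mc \<Rightarrow> 'n mc set \<Rightarrow> ('n mc \<Rightarrow> 'n mc) \<Rightarrow> bool" where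
  "intertwines c i V F \<longleftrightarrow> C1_on V F \<and>
     (\<forall>\<eta>\<in>V. \<forall>x. DF F \<eta> (i * x) = c *\<^sub>R (i * DF F \<eta> x))"

lemma C1_on_differentiable: "C1_on V F \<Longrightarrow> \<eta> \<in> V \<Longrightarrow> F differentiable (at \<eta>)"
  unfolding C1_on_def differentiable_def by blast

lemma C1_on_linear_DF: "C1_on V F \<Longrightarrow> \<eta> \<in> V \<Longrightarrow> linear (DF F \<eta>)"
  by (intro linear_frechet_derivative C1_on_differentiable)

lemma C1_on_left_comp:
  assumes L: "bounded_linear L" and F: "C1_on V F"
  shows "C1_on V (L \<circ> F)"
proof -
  obtain F' where F': "\<And>x. x \<in> V \<Longrightarrow> (F has_derivative blinfun_apply (F' x)) (at x)"
    and cont: "continuous_on V F'"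
    using F unfolding C1_on_def by blast
  have "(L \<circ> F has_derivative blinfun_apply (Blinfun L o\<^sub>L F' x)) (at x)" if "x \<in> V" for x
  proof -
    have "blinfun_apply (Blinfun L o\<^sub>L F' x) = (\<lambda>h. L (F' x h))"
      by (simp add: fun_eq_iff bounded_linear_Blinfun_apply[OF L])
    with bounded_linear.has_derivative[OF L F'[OF that]] show ?thesis by (simp add: o_def)
  qed
  moreover have "continuous_on V (\<lambda>x. Blinfun L o\<^sub>L F' x)"
    by (intro continuous_intros cont)
  ultimately show ?thesis
    unfolding C1_on_def by (intro exI[of _ "\<lambda>x. Blinfun L o\<^sub>L F' x"] conjI ballI)
qed

lemma C1_on_right_comp:
  assumes L: "bounded_linear L" and F: "C1_on V F" and W: "L ` W \<subseteq> V"
  shows "C1_on W (F \<circ> L)"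
proof -
  obtain F' where F': "\<And>x. x \<in> V \<Longrightarrow> (F has_derivative blinfun_apply (F' x)) (at x)"
    and cont: "continuous_on V F'"
    using F unfolding C1_on_def by blast
  have "(F \<circ> L has_derivative blinfun_apply (F' (L x) o\<^sub>L Blinfun L)) (at x)" if "x \<in> W" for x
  proof -
    have "L x \<in> V" using W that by blast
    moreover have "blinfun_apply (F' (L x) o\<^sub>L Blinfun L) = F' (L x) \<circ> L"
      by (simp add: fun_eq_iff bounded_linear_Blinfun_apply[OF L])
    ultimately show ?thesis
      using diff_chain_at[OF bounded_linear_imp_has_derivative[OF L] F'] by simp
  qed
  moreover have "continuous_on W (\<lambda>x. F' (L x) o\<^sub>L Blinfun L)"
    by (intro continuous_intros continuous_on_compose2[OF cont _ W]
        linear_continuous_on L)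
  ultimately show ?thesis
    unfolding C1_on_def by (intro exI[of _ "\<lambda>x. F' (L x) o\<^sub>L Blinfun L"] conjI ballI)
qed

lemma DF_left_comp:
  assumes "bounded_linear L" and "F differentiable (at \<eta>)"
  shows "DF (L \<circ> F) \<eta> = L \<circ> DF F \<eta>"
  using bounded_linear.has_derivative[OF assms(1)
      assms(2)[unfolded frechet_derivative_works]]
  by (intro frechet_derivative_at[symmetric]) (simp add: o_def)

lemma DF_right_comp:
  assumes "bounded_linear L" and "F differentiable (at (L \<eta>))"
  shows "DF (F \<circ> L) \<eta> = DF F (L \<eta>) \<circ> L"
  using diff_chain_at[OF bounded_linear_imp_has_derivative[OF assms(1)]
      assms(2)[unfolded frechet_derivative_works]]
  by (intro frechet_derivative_at[symmetric])

lemma e_admissibleD: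
  assumes "e_admissible \<sigma> i"
  shows "bounded_linear \<sigma>" "\<sigma> (\<sigma> x) = x" "\<sigma> (i * x) = - (i * \<sigma> x)" "i * (i * x) = - x"
  using assms unfolding e_admissible_def mc_involution_def
  by (auto simp: linear_conv_bounded_linear fun_eq_iff power2_eq_square
      simp flip: mult.assoc)

text \<open>
  The elements \<open>a\<close> and \<open>i * b\<close> are the projections \<open>(x \<plusminus> \<sigma> x) / 2\<close> to the eigenspaces of \<open>\<sigma>\<close>.
\<close>

lemma fixed_space_decomposition:
  assumes "e_admissible \<sigma> i"
  obtains a b where "a \<in> fixed_space \<sigma>" "b \<in> fixed_space \<sigma>" "x = a + i * b"
proof
  note \<sigma> = e_admissibleD[OF assms]
  interpret bounded_linear \<sigma> by (rule \<sigma>(1))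
  let ?a = "(1/2) *\<^sub>R (x + \<sigma> x)" and ?b = "(1/2) *\<^sub>R (i * (\<sigma> x - x))"
  show "?a \<in> fixed_space \<sigma>"
    by (simp add: fixed_space_def scaleR add \<sigma> add.commute)
  show "?b \<in> fixed_space \<sigma>"
    by (simp add: fixed_space_def scaleR \<sigma> diff algebra_simps)
  have "?a + i * ?b = (1/2) *\<^sub>R x + (1/2) *\<^sub>R x"
    by (simp add: \<sigma>(4) algebra_simps)
  also have "\<dots> = x" by (simp flip: scaleR_left.add)
  finally show "x = ?a + i * ?b" ..
qed

text \<open>
  On \<open>i * b\<close> the required rule reads \<open>- D b = c\<^sup>2 (i * (i * D b))\<close>, which is where \<open>c\<^sup>2 = 1\<close> enters.
\<close>

lemma commutation_from_fixed_space:
  assumes adm: "e_admissible \<sigma> i" and D: "linear D" and c: "c * c = 1"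
    and fix_sp: "\<And>\<beta>. \<beta> \<in> fixed_space \<sigma> \<Longrightarrow> D (i * \<beta>) = c *\<^sub>R (i * D \<beta>)"
  shows "D (i * x) = c *\<^sub>R (i * D x)"
proof -
  note \<sigma> = e_admissibleD[OF adm]
  obtain a b where ab: "a \<in> fixed_space \<sigma>" "b \<in> fixed_space \<sigma>" and x: "x = a + i * b"
    using fixed_space_decomposition[OF adm] .
  have "D (i * x) = D (i * a) - D b"
    by (simp add: x distrib_left \<sigma>(4) linear_diff[OF D])
  also have "\<dots> = c *\<^sub>R (i * D a) - (c * c) *\<^sub>R D b"
    by (simp add: fix_sp[OF ab(1)] c)
  also have "\<dots> = c *\<^sub>R (i * (D a + D (i * b)))"
    by (simp add: fix_sp[OF ab(2)] distrib_left scaleR_diff_right \<sigma>(4))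
  also have "\<dots> = c *\<^sub>R (i * D x)"
    by (simp add: x linear_add[OF D])
  finally show ?thesis .
qed

lemma cauchy_riemann_iff_intertwines:
  assumes "e_admissible \<sigma> i"
  shows "cauchy_riemann \<sigma> i V F \<longleftrightarrow> intertwines 1 i V F"
  using commutation_from_fixed_space[OF assms C1_on_linear_DF, of V F _ 1]
  unfolding cauchy_riemann_def intertwines_def by auto

lemma anti_cauchy_riemann_iff_intertwines:
  assumes "e_admissible \<sigma> i"
  shows "anti_cauchy_riemann \<sigma> i V F \<longleftrightarrow> intertwines (-1) i V F"
  using commutation_from_fixed_space[OF assms C1_on_linear_DF, of V F _ "-1"]
  unfolding anti_cauchy_riemann_def intertwines_def by auto

lemma Hol_iff_intertwines: "G \<in> Hol i V \<longleftrightarrow> intertwines 1 i V G"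
  unfolding Hol_def intertwines_def mult_by_def by (auto simp: fun_eq_iff)

text \<open>
  The sign flips because moving \<open>i\<close> through \<open>\<sigma>\<close> turns it into \<open>- i\<close>: on the left this happens
  after \<open>D\<close> has moved \<open>i\<close> out, on the right before, where linearity of \<open>D\<close> carries the sign along.
\<close>

lemma intertwines_left_comp:
  assumes adm: "e_admissible \<sigma> i" and F: "intertwines c i V F"
  shows "intertwines (-c) i V (\<sigma> \<circ> F)"
proof -
  note \<sigma> = e_admissibleD[OF adm]
  interpret bounded_linear \<sigma> by (rule \<sigma>(1))
  have C1: "C1_on V F" using F unfolding intertwines_def by blast
  have "DF (\<sigma> \<circ> F) \<eta> = \<sigma> \<circ> DF F \<eta>" if "\<eta> \<in> V" for \<eta>
    by (intro DF_left_comp \<sigma>(1) C1_on_differentiable[OF C1 that])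
  then show ?thesis
    using F C1_on_left_comp[OF \<sigma>(1) C1] unfolding intertwines_def
    by (simp add: scaleR \<sigma>(3))
qed

lemma intertwines_right_comp:
  assumes adm: "e_admissible \<sigma> i" and F: "intertwines c i V F"
  shows "intertwines (-c) i (\<sigma> ` V) (F \<circ> \<sigma>)"
proof -
  note \<sigma> = e_admissibleD[OF adm]
  have C1: "C1_on V F" using F unfolding intertwines_def by blast
  have "\<sigma> ` (\<sigma> ` V) \<subseteq> V" by (auto simp: \<sigma>(2))
  note C1' = C1_on_right_comp[OF \<sigma>(1) C1 this]
  have DF': "DF (F \<circ> \<sigma>) (\<sigma> \<eta>) = DF F \<eta> \<circ> \<sigma>" if "\<eta> \<in> V" for \<eta>
    using DF_right_comp[OF \<sigma>(1), of F "\<sigma> \<eta>"] C1_on_differentiable[OF C1 that]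
    by (simp add: \<sigma>(2))
  have "DF F \<eta> (- (i * \<sigma> x)) = - (c *\<^sub>R (i * DF F \<eta> (\<sigma> x)))" if "\<eta> \<in> V" for \<eta> x
    using F that linear_neg[OF C1_on_linear_DF[OF C1 that]] unfolding intertwines_def by simp
  then show ?thesis
    using C1' unfolding intertwines_def by (simp add: DF' \<sigma>(3))
qed

lemma intertwines_left_comp_iff:
  assumes adm: "e_admissible \<sigma> i"
  shows "intertwines c i V (\<sigma> \<circ> F) \<longleftrightarrow> intertwines (-c) i V F"
proof -
  have "\<sigma> \<circ> (\<sigma> \<circ> F) = F" by (simp add: fun_eq_iff e_admissibleD[OF adm])
  then show ?thesis
    using intertwines_left_comp[OF adm, of c V "\<sigma> \<circ> F"]
      intertwines_left_comp[OF adm, of "-c" V F] by auto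
qed

lemma intertwines_right_comp_iff:
  assumes adm: "e_admissible \<sigma> i"
  shows "intertwines c i (\<sigma> ` V) (F \<circ> \<sigma>) \<longleftrightarrow> intertwines (-c) i V F"
proof -
  have "F \<circ> \<sigma> \<circ> \<sigma> = F" "\<sigma> ` \<sigma> ` V = V"
    by (simp_all add: fun_eq_iff image_image e_admissibleD[OF adm])
  then show ?thesis
    using intertwines_right_comp[OF adm, of c "\<sigma> ` V" "F \<circ> \<sigma>"]
      intertwines_right_comp[OF adm, of "-c" V F] by auto
qed

theorem proposition4p11:
  fixes \<sigma> :: "'n::finite mc \<Rightarrow> 'n mc" and i :: "'n mc" and U :: "'n mc set"
  assumes "e_admissible \<sigma> i" and "open U"
  shows
    "(\<forall>F. C1_on U F \<longrightarrow>
        (anti_cauchy_riemann \<sigma> i U F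
           \<longleftrightarrow> (\<forall>\<eta>\<in>U. DF F \<eta> \<circ> mult_by i = uminus \<circ> mult_by i \<circ> DF F \<eta>)) \<and>
        (anti_cauchy_riemann \<sigma> i U F \<longleftrightarrow> cauchy_riemann \<sigma> i U (\<sigma> \<circ> F)) \<and>
        (anti_cauchy_riemann \<sigma> i U F \<longleftrightarrow> cauchy_riemann \<sigma> i (\<sigma> ` U) (F \<circ> \<sigma>))) \<and>
     (\<forall>\<tau>. e_admissible \<tau> i \<longrightarrow>
        antiHol \<tau> i U = antiHol \<sigma> i U \<and>
        antiHol \<sigma> i U = {\<tau> \<circ> G | G. G \<in> Hol i U} \<and>
        antiHol \<sigma> i U = {G \<circ> \<tau> | G. G \<in> Hol i (\<tau> ` U)})"
proof -
  note anti = anti_cauchy_riemann_iff_intertwines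
  have anti_iff_cr: "anti_cauchy_riemann \<sigma> i U F \<longleftrightarrow> cauchy_riemann \<sigma> i U (\<sigma> \<circ> F)"
    "anti_cauchy_riemann \<sigma> i U F \<longleftrightarrow> cauchy_riemann \<sigma> i (\<sigma> ` U) (F \<circ> \<sigma>)" for F
    by (simp_all only: anti[OF assms(1)] cauchy_riemann_iff_intertwines[OF assms(1)]
        intertwines_left_comp_iff[OF assms(1)] intertwines_right_comp_iff[OF assms(1)])
  have anti_iff_DF: "anti_cauchy_riemann \<sigma> i U F
      \<longleftrightarrow> (\<forall>\<eta>\<in>U. DF F \<eta> \<circ> mult_by i = uminus \<circ> mult_by i \<circ> DF F \<eta>)" if "C1_on U F" for F
    using that by (simp add: anti[OF assms(1)] intertwines_def mult_by_def fun_eq_iff)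
  have antiHol_eq: "antiHol \<tau> i U = {F. intertwines (-1) i U F}" if "e_admissible \<tau> i" for \<tau>
    by (simp add: antiHol_def anti[OF that])
  have antiHol_images: "{F. intertwines (-1) i U F} = {\<tau> \<circ> G | G. G \<in> Hol i U}"
    "{F. intertwines (-1) i U F} = {G \<circ> \<tau> | G. G \<in> Hol i (\<tau> ` U)}"
    if \<tau>: "e_admissible \<tau> i" for \<tau>
  proof -
    (* As \<tau> is its own inverse, the preimage G of F is obtained by composing F with \<tau> again. *)
    have inv: "\<tau> \<circ> (\<tau> \<circ> F) = F" "F \<circ> \<tau> \<circ> \<tau> = F" for F
      by (simp_all add: fun_eq_iff e_admissibleD[OF \<tau>])
    have "(\<exists>G. F = \<tau> \<circ> G \<and> P G) \<longleftrightarrow> P (\<tau> \<circ> F)"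
      for F :: "'n mc \<Rightarrow> 'n mc" and P
      by (auto simp: inv intro!: exI[of _ "\<tau> \<circ> F"])
    moreover have "(\<exists>G. F = G \<circ> \<tau> \<and> P G) \<longleftrightarrow> P (F \<circ> \<tau>)"
      for F :: "'n mc \<Rightarrow> 'n mc" and P
      by (auto simp: inv intro!: exI[of _ "F \<circ> \<tau>"])
    ultimately show "{F. intertwines (-1) i U F} = {\<tau> \<circ> G | G. G \<in> Hol i U}"
      "{F. intertwines (-1) i U F} = {G \<circ> \<tau> | G. G \<in> Hol i (\<tau> ` U)}"
      by (simp_all add: Hol_iff_intertwines intertwines_left_comp_iff[OF \<tau>]
          intertwines_right_comp_iff[OF \<tau>])
  qed
  show ?thesis
  proof (intro conjI allI impI)
    fix F :: "'n mc \<Rightarrow> 'n mc" assume "C1_on U F"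
    then show "anti_cauchy_riemann \<sigma> i U F
        \<longleftrightarrow> (\<forall>\<eta>\<in>U. DF F \<eta> \<circ> mult_by i = uminus \<circ> mult_by i \<circ> DF F \<eta>)"
      by (rule anti_iff_DF)
  next
    fix \<tau> :: "'n mc \<Rightarrow> 'n mc" assume \<tau>: "e_admissible \<tau> i"
    show "antiHol \<tau> i U = antiHol \<sigma> i U"
      by (simp only: antiHol_eq[OF \<tau>] antiHol_eq[OF assms(1)])
    show "antiHol \<sigma> i U = {\<tau> \<circ> G | G. G \<in> Hol i U}"
      "antiHol \<sigma> i U = {G \<circ> \<tau> | G. G \<in> Hol i (\<tau> ` U)}"
      unfolding antiHol_eq[OF assms(1)] by (rule antiHol_images[OF \<tau>])+
  qed (rule anti_iff_cr)+
qed

end
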